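(* Let $\mathcal{K}(x)=e^{-|x|}/2$ and $d>0$. Let $f:\mathbb{R}\to\mathbb{R}$ be smooth and assume there is $a\in(0,1)$ such that $f(0)=f(a)=f(1)=0$, $f<0$ on $(0,a)$, $f>0$ on $(a,1)$, $f'(0)<0$, $f'(1)<0$, $f'(a)>0$ and $\int_0^1 f(u)\,\mathrm{d}u>0$. Let $g(u):=u-\frac{f(u)}{d}$ and assume that there exist $0<\beta<\gamma<1$ such that $g'>0$ on $[0,\beta)\cup(\gamma,1]$, $g'<0$ on $(\beta,\gamma)$ and $g'(\beta)=g'(\gamma)=0$. Let $u_+\in(\gamma,1)$ be such that $f'(u_+)=0$ and $f'(u)<0$ for all $u\in(u_+,1]$, and assume $g(u_+)<0$. Then for all $\ell>0$ the solution $u_\ell$ of the Cauchy problem $$\partial_t u = d(-u+\mathcal{K}*u)+f(u),\quad t>0,\ x\in\mathbb{R},\qquad u(0,x)=\mathbf{1}_{[-\ell,\ell]}(x),\quad x\in\mathbb{R},$$ satisfies $$U(x)\le\liminf_{t\to+\infty}u_\ell(t,x)\quad\text{uniformly in }x\in\mathbb{R}\setminus\{\pm x_0\},$$ where $U$ is a discontinuous ground state with discontinuity points at $\pm x_0$, with $0<x_0\le\ell$.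
   Context: $\mathcal{K}*u$ denotes convolution on $\mathbb{R}$ in the space variable. The Cauchy problem has a unique global solution $u_\ell\in\mathscr{C}^1((0,+\infty),L^1(\mathbb{R})\cap L^\infty(\mathbb{R}))\cap\mathscr{C}^0([0,+\infty),L^1(\mathbb{R})\cap L^\infty(\mathbb{R}))$, which is what "the solution" refers to. A ground state is a bounded, even function $U\in L^2(\mathbb{R})$, possibly discontinuous, with $0=d(-U+\mathcal{K}*U)+f(U)$ on $\mathbb{R}$, $U(\pm\infty)=0$ and $U>0$ on $\mathbb{R}$. The number $u_+$ exists because $f'(\gamma)=d>0$ and $f'(1)<0$. "$U(x)\le\liminf_{t\to+\infty}u_\ell(t,x)$ uniformly in $x\in A$" means: for every $\varepsilon>0$ there is $T>0$ such that $u_\ell(t,x)\ge U(x)-\varepsilon$ for all $t\ge T$ and $x\in A$. *)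

theory Defs
  imports "HOL-Analysis.Analysis" "HOL-Probability.Essential_Supremum"
begin

definition smooth_real :: "(real \<Rightarrow> real) \<Rightarrow> bool" where
  "smooth_real f \<longleftrightarrow> (\<forall>n. (deriv ^^ n) f differentiable_on UNIV)"

definition exp_kernel :: "real \<Rightarrow> real" where
  "exp_kernel x = exp (- \<bar>x\<bar>) / 2"

definition conv :: "(real \<Rightarrow> real) \<Rightarrow> (real \<Rightarrow> real) \<Rightarrow> real \<Rightarrow> real" where
  "conv K v x = (LINT y|lborel. K (x - y) * v y)"

text \<open>The space \<open>L\<^sup>1(\<real>) \<inter> L\<^sup>\<infinity>(\<real>)\<close> and its norm, the sum of the two norms,
  on the level of representatives.\<close>

definition L1_Linf :: "(real \<Rightarrow> real) \<Rightarrow> bool" where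
  "L1_Linf v \<longleftrightarrow> integrable lborel v \<and> esssup lborel (\<lambda>x. ereal \<bar>v x\<bar>) < \<infinity>"

definition norm_L1_Linf :: "(real \<Rightarrow> real) \<Rightarrow> ereal" where
  "norm_L1_Linf v = ereal (LINT x|lborel. \<bar>v x\<bar>) + esssup lborel (\<lambda>x. ereal \<bar>v x\<bar>)"

definition C0_L1_Linf :: "real set \<Rightarrow> (real \<Rightarrow> real \<Rightarrow> real) \<Rightarrow> bool" where
  "C0_L1_Linf I u \<longleftrightarrow> (\<forall>t\<in>I. L1_Linf (u t) \<and>
     ((\<lambda>s. norm_L1_Linf (\<lambda>x. u s x - u t x)) \<longlongrightarrow> 0) (at t within I))"

definition C1_L1_Linf :: "real set \<Rightarrow> (real \<Rightarrow> real \<Rightarrow> real) \<Rightarrow> bool" where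
  "C1_L1_Linf I u \<longleftrightarrow> (\<exists>v. C0_L1_Linf I v \<and> (\<forall>t\<in>I. L1_Linf (u t) \<and>
     ((\<lambda>s. norm_L1_Linf (\<lambda>x. (u s x - u t x) / (s - t) - v t x)) \<longlongrightarrow> 0) (at t within I)))"

text \<open>The regularity conditions concern the classes of \<open>u t\<close> in \<open>L\<^sup>1 \<inter> L\<^sup>\<infinity>\<close>. The equation
  and the initial condition are required at every point; together with continuity in time
  at every fixed \<open>x\<close>, up to the initial time, this selects the canonical representative of the
  solution, without which statements at every \<open>x\<close> (rather than almost every \<open>x\<close>) would make no
  sense.\<close>

definition cauchy_solution ::
  "(real \<Rightarrow> real) \<Rightarrow> real \<Rightarrow> (real \<Rightarrow> real) \<Rightarrow> (real \<Rightarrow> real) \<Rightarrow> (real \<Rightarrow> real \<Rightarrow> real) \<Rightarrow> bool" where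
  "cauchy_solution K d f u0 u \<longleftrightarrow>
     C1_L1_Linf {0<..} u \<and> C0_L1_Linf {0..} u \<and>
     (\<forall>x. u 0 x = u0 x) \<and>
     (\<forall>x. continuous_on {0..} (\<lambda>t. u t x)) \<and>
     (\<forall>t>0. \<forall>x. ((\<lambda>s. u s x) has_real_derivative
        d * (- u t x + conv K (u t) x) + f (u t x)) (at t))"

definition ground_state ::
  "(real \<Rightarrow> real) \<Rightarrow> real \<Rightarrow> (real \<Rightarrow> real) \<Rightarrow> (real \<Rightarrow> real) \<Rightarrow> bool" where
  "ground_state K d f U \<longleftrightarrow>
     bounded (range U) \<and> (\<forall>x. U (- x) = U x) \<and>
     U \<in> borel_measurable lborel \<and> integrable lborel (\<lambda>x. (U x)\<^sup>2) \<and>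
     (\<forall>x. 0 = d * (- U x + conv K U x) + f (U x)) \<and>
     (U \<longlongrightarrow> 0) at_top \<and> (U \<longlongrightarrow> 0) at_bot \<and> (\<forall>x. U x > 0)"

definition le_liminf_uniformly_on ::
  "real set \<Rightarrow> (real \<Rightarrow> real) \<Rightarrow> (real \<Rightarrow> real \<Rightarrow> real) \<Rightarrow> bool" where
  "le_liminf_uniformly_on A U u \<longleftrightarrow>
     (\<forall>\<epsilon>>0. \<exists>T>0. \<forall>t\<ge>T. \<forall>x\<in>A. u t x \<ge> U x - \<epsilon>)"

end

theory Submission
  imports Defs
begin

text \<open>A stationary solution is a solution of \<open>g(U) = K * U\<close>. Let \<open>b\<close> be the zero of \<open>g\<close> in
  \<open>(u\<^sub>p, 1)\<close>. Since \<open>f' < 0\<close> at \<open>0\<close> and at \<open>b\<close>, there is \<open>\<kappa> > 1\<close> with \<open>g' > \<kappa>\<close> near both zeros, so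
  for small \<open>r\<close> the function \<open>g\<close> has two contracting inverse branches \<open>hm\<close> and \<open>hp\<close> on
  \<open>[0, \<kappa> r]\<close>, starting at \<open>0\<close> and \<open>b\<close>. For small \<open>x0\<close> the monotone iteration \<open>U \<mapsto> hp(K * U)\<close> on \<open>[- x0, x0]\<close>,
  \<open>U \<mapsto> hm(K * U)\<close> elsewhere, keeps \<open>K * U\<close> in the domain of the branches, and its limit is a ground
  state which jumps exactly at \<open>\<plusminus>x0\<close>.

  The solution \<open>u\<close> is nonnegative, and on \<open>[- l, l]\<close>, where it starts at \<open>1 \<ge> b\<close>, it never drops
  below \<open>b\<close> because \<open>\<partial>\<^sub>t u \<ge> - d g(u)\<close>. So if \<open>x0 \<le> l\<close>, then wherever \<open>u < U\<close>, the values of \<open>u\<close>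
  and \<open>U\<close> lie in the same region of expansion of \<open>g\<close>. As \<open>K\<close> has mass one and \<open>\<kappa> > 1\<close>, the supremum
  of \<open>U - u\<close> tends to \<open>0\<close> or below.\<close>

section \<open>Convolution with the exponential kernel\<close>

lemma exp_abs_integral:
  fixes c :: real
  assumes "0 < c"
  shows "has_bochner_integral lborel (\<lambda>x. exp (- c * \<bar>x\<bar>)) (2 / c)"
proof -
  have "(\<integral>\<^sup>+ x. ennreal (exp (- c * x)) * indicator {0..} x \<partial>lborel) = ennreal (0 - (- exp (- c * 0) / c))"
  proof (rule nn_integral_FTC_atLeast)
    show "((\<lambda>x. - exp (- c * x) / c) has_real_derivative exp (- c * x)) (at x)" for x
      using assms by (auto intro!: derivative_eq_intros)
    have "((\<lambda>x. exp (- (c * x))) \<longlongrightarrow> 0) at_top"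
      by (rule filterlim_compose[OF exp_at_bot], rule filterlim_compose[OF filterlim_uminus_at_bot_at_top],
          rule filterlim_tendsto_pos_mult_at_top[OF tendsto_const assms filterlim_ident])
    then show "((\<lambda>x. - exp (- c * x) / c) \<longlongrightarrow> 0) at_top"
      using tendsto_divide[OF tendsto_minus tendsto_const, of "\<lambda>x. exp (- (c * x))" 0 at_top c] assms by simp
  qed auto
  also have "(\<integral>\<^sup>+ x. ennreal (exp (- c * x)) * indicator {0..} x \<partial>lborel)
      = (\<integral>\<^sup>+ x. ennreal (indicator {0..} x *\<^sub>R exp (- c * \<bar>x\<bar>)) \<partial>lborel)"
    by (intro nn_integral_cong) (auto split: split_indicator)
  finally have "has_bochner_integral lborel (\<lambda>x. indicator {0..} x *\<^sub>R exp (- c * \<bar>x\<bar>)) (1 / c)"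
    using assms by (intro has_bochner_integral_nn_integral) auto
  from has_bochner_integral_even_function[OF this] show ?thesis by simp
qed

lemma integrable_indicator_Icc: "integrable lborel (indicat_real {a..b::real})"
  by (rule integrable_real_indicator) (simp_all add: emeasure_lborel_Icc_eq)

lemma integrable_exp_abs: "0 < \<mu> \<Longrightarrow> integrable lborel (\<lambda>x::real. exp (- \<mu> * \<bar>x\<bar>))"
  using exp_abs_integral by (rule integrable.intros)

lemma exp_kernel_nonneg: "0 \<le> exp_kernel x"
  and exp_kernel_le: "exp_kernel x \<le> 1 / 2"
  and exp_kernel_minus: "exp_kernel (- x) = exp_kernel x"
  by (auto simp: exp_kernel_def)

lemma continuous_exp_kernel: "continuous_on S exp_kernel"
  unfolding exp_kernel_def by (intro continuous_intros) auto

lemma exp_kernel_measurable [measurable]: "exp_kernel \<in> borel_measurable borel"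
  by (intro borel_measurable_continuous_onI continuous_exp_kernel)

lemma exp_kernel_integral: "has_bochner_integral lborel (\<lambda>y. exp_kernel (x - y)) 1"
proof -
  have "has_bochner_integral lborel exp_kernel 1"
    using has_bochner_integral_divide[OF exp_abs_integral[of 1], of 2]
    by (simp add: exp_kernel_def[abs_def])
  then show ?thesis
    using lborel_has_bochner_integral_real_affine_iff[of "-1" exp_kernel 1 x] by simp
qed

lemma exp_kernel_integrable: "integrable lborel (\<lambda>y. exp_kernel (x - y))"
  using exp_kernel_integral by (rule integrable.intros)

text \<open>Serves constants and weights, where the integrability comes from the kernel.
  \<open>conv_integrable_L1\<close> serves the solution, whose boundedness is only
  essential.\<close>

lemma conv_integrable_bounded:
  assumes "v \<in> borel_measurable lborel" "\<And>x. \<bar>v x\<bar> \<le> B"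
  shows "integrable lborel (\<lambda>y. exp_kernel (x - y) * v y)"
proof (rule Bochner_Integration.integrable_bound)
  show "integrable lborel (\<lambda>y. exp_kernel (x - y) * B)"
    by (intro integrable_mult_left exp_kernel_integrable)
  show "AE y in lborel. norm (exp_kernel (x - y) * v y) \<le> norm (exp_kernel (x - y) * B)"
    using assms(2) exp_kernel_nonneg
    by (intro AE_I2) (auto simp: abs_mult intro!: mult_left_mono intro: order_trans[OF _ abs_ge_self])
qed (use assms in measurable)

lemma conv_integrable_L1:
  assumes "integrable lborel v"
  shows "integrable lborel (\<lambda>y. exp_kernel (x - y) * v y)"
proof (rule Bochner_Integration.integrable_bound[OF assms])
  show "AE y in lborel. norm (exp_kernel (x - y) * v y) \<le> norm (v y)"
  proof (intro AE_I2)
    fix y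
    have "\<bar>exp_kernel (x - y)\<bar> \<le> 1"
      using exp_kernel_nonneg[of "x - y"] exp_kernel_le[of "x - y"] by linarith
    then show "norm (exp_kernel (x - y) * v y) \<le> norm (v y)"
      by (simp add: abs_mult mult_left_le_one_le)
  qed
qed (use assms in measurable)

text \<open>The order is required almost everywhere only, since bounds on \<open>u\<close> read off
  the norm hold up to null sets.\<close>

lemma conv_mono:
  assumes "integrable lborel (\<lambda>y. exp_kernel (x - y) * v y)"
    and "integrable lborel (\<lambda>y. exp_kernel (x - y) * w y)"
    and "AE y in lborel. v y \<le> w y"
  shows "conv exp_kernel v x \<le> conv exp_kernel w x"
  unfolding conv_def using assms exp_kernel_nonneg
  by (intro integral_mono_AE) (auto intro: mult_left_mono)

lemma conv_const: "conv exp_kernel (\<lambda>_. c) x = c"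
  using exp_kernel_integral[of x]
  by (simp add: conv_def has_bochner_integral_iff)

text \<open>Dominated convergence with majorant \<open>\<bar>v y\<bar>\<close>, as the kernel is
  continuous and at most one. Hence a fixed point can jump only where the branch is
  switched.\<close>

lemma continuous_conv:
  assumes "integrable lborel v"
  shows "continuous_on UNIV (conv exp_kernel v)"
proof -
  have "isCont (conv exp_kernel v) x" for x
    unfolding continuous_at_sequentially
  proof (intro allI impI)
    fix X :: "nat \<Rightarrow> real" assume X: "X \<longlonglongrightarrow> x"
    have "(\<lambda>n. LINT y|lborel. exp_kernel (X n - y) * v y) \<longlonglongrightarrow> (LINT y|lborel. exp_kernel (x - y) * v y)"
    proof (rule integral_dominated_convergence)
      show "integrable lborel (\<lambda>y. \<bar>v y\<bar>)" using assms by simp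
      show "AE y in lborel. (\<lambda>n. exp_kernel (X n - y) * v y) \<longlonglongrightarrow> exp_kernel (x - y) * v y"
      proof (intro AE_I2 tendsto_mult_right)
        fix y
        have "(\<lambda>n. X n - y) \<longlonglongrightarrow> x - y" by (intro tendsto_intros X)
        then show "(\<lambda>n. exp_kernel (X n - y)) \<longlonglongrightarrow> exp_kernel (x - y)"
          by (rule continuous_on_tendsto_compose[OF continuous_exp_kernel[of UNIV]]) auto
      qed
      show "AE y in lborel. norm (exp_kernel (X n - y) * v y) \<le> \<bar>v y\<bar>" for n
      proof (intro AE_I2)
        fix y
        have "\<bar>exp_kernel (X n - y)\<bar> \<le> 1"
          using exp_kernel_nonneg[of "X n - y"] exp_kernel_le[of "X n - y"] by linarith
        then show "norm (exp_kernel (X n - y) * v y) \<le> \<bar>v y\<bar>"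
          by (simp add: abs_mult mult_left_le_one_le)
      qed
    qed (use assms in measurable)
    then show "(conv exp_kernel v \<circ> X) \<longlonglongrightarrow> conv exp_kernel v x"
      by (simp add: conv_def o_def)
  qed
  then show ?thesis by (simp add: continuous_on_eq_continuous_at)
qed

lemma conv_even:
  assumes "\<And>x. v (- x) = v x"
  shows "conv exp_kernel v (- x) = conv exp_kernel v x"
proof -
  have "(LINT y|lborel. exp_kernel (- x - y) * v y)
      = (LINT y|lborel. exp_kernel (- x - (0 + - 1 * y)) * v (0 + - 1 * y))"
    by (subst lborel_integral_real_affine[where c = "- 1" and t = 0]) auto
  also have "\<dots> = (LINT y|lborel. exp_kernel (x - y) * v y)"
    by (simp add: assms exp_kernel_minus[of "x - _", symmetric])
  finally show ?thesis by (simp add: conv_def)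
qed

text \<open>The triangle inequality moves the weight out of the convolution, up to a kernel of mass
  \<open>1 / (1 - \<mu>)\<close>.\<close>

lemma conv_exp_weight:
  assumes "0 \<le> \<mu>" "\<mu> < 1"
  shows "conv exp_kernel (\<lambda>y. exp (- \<mu> * \<bar>y\<bar>)) x \<le> exp (- \<mu> * \<bar>x\<bar>) / (1 - \<mu>)"
proof -
  let ?G = "\<lambda>s. exp (- (1 - \<mu>) * \<bar>s\<bar>)"
  have "has_bochner_integral lborel (\<lambda>y. ?G (x + - 1 * y)) (2 / (1 - \<mu>))"
    using exp_abs_integral[of "1 - \<mu>"] assms
      lborel_has_bochner_integral_real_affine_iff[of "-1" ?G "2 / (1 - \<mu>)" x] by simp
  from has_bochner_integral_mult_right[OF this, of "exp (- \<mu> * \<bar>x\<bar>) / 2"]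
  have G: "has_bochner_integral lborel (\<lambda>y. exp (- \<mu> * \<bar>x\<bar>) / 2 * ?G (x + - 1 * y))
      (exp (- \<mu> * \<bar>x\<bar>) / (1 - \<mu>))" by simp
  have "conv exp_kernel (\<lambda>y. exp (- \<mu> * \<bar>y\<bar>)) x
      \<le> (LINT y|lborel. exp (- \<mu> * \<bar>x\<bar>) / 2 * ?G (x + - 1 * y))"
    unfolding conv_def
  proof (rule integral_mono)
    show "integrable lborel (\<lambda>y. exp_kernel (x - y) * exp (- \<mu> * \<bar>y\<bar>))"
      using assms by (intro conv_integrable_bounded[where B = 1]) auto
    fix y
    have "\<mu> * \<bar>x\<bar> \<le> \<mu> * (\<bar>y\<bar> + \<bar>x - y\<bar>)"
      using assms by (intro mult_left_mono) auto
    then have "- \<bar>x - y\<bar> + - \<mu> * \<bar>y\<bar> \<le> - \<mu> * \<bar>x\<bar> + - (1 - \<mu>) * \<bar>x - y\<bar>"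
      by (simp add: algebra_simps)
    then show "exp_kernel (x - y) * exp (- \<mu> * \<bar>y\<bar>) \<le> exp (- \<mu> * \<bar>x\<bar>) / 2 * ?G (x + - 1 * y)"
      by (simp add: exp_kernel_def flip: exp_add)
  qed (use G in \<open>auto intro: integrable.intros\<close>)
  also have "\<dots> = exp (- \<mu> * \<bar>x\<bar>) / (1 - \<mu>)"
    using G by (rule has_bochner_integral_integral_eq)
  finally show ?thesis .
qed

text \<open>For \<open>y\<close> in the interval,
  \<open>\<bar>x\<bar> \<le> \<bar>x - y\<bar> + r\<close>. The factor \<open>r\<close> in the bound
  is what makes a narrow plateau contribute little.\<close>

lemma conv_indicator:
  assumes "0 \<le> r"
  shows "conv exp_kernel (indicat_real {- r..r}) x \<le> r * exp r * exp (- \<bar>x\<bar>)"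
proof -
  have "conv exp_kernel (indicat_real {- r..r}) x
      \<le> (LINT y|lborel. exp r * exp (- \<bar>x\<bar>) / 2 * indicat_real {- r..r} y)"
    unfolding conv_def
  proof (rule integral_mono)
    show "integrable lborel (\<lambda>y. exp_kernel (x - y) * indicat_real {- r..r} y)"
      by (intro conv_integrable_bounded[where B = 1]) (auto simp: indicator_def)
    show "integrable lborel (\<lambda>y. exp r * exp (- \<bar>x\<bar>) / 2 * indicat_real {- r..r} y)"
      by (intro integrable_mult_right integrable_indicator_Icc)
    show "exp_kernel (x - y) * indicat_real {- r..r} y
        \<le> exp r * exp (- \<bar>x\<bar>) / 2 * indicat_real {- r..r} y" for y
    proof (cases "y \<in> {- r..r}")
      case True
      then have "- \<bar>x - y\<bar> \<le> r + - \<bar>x\<bar>" by auto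
      with True show ?thesis by (simp add: exp_kernel_def flip: exp_add)
    qed simp
  qed
  also have "\<dots> = r * exp r * exp (- \<bar>x\<bar>)" using assms by simp
  finally show ?thesis .
qed

lemma conv_indicator_pos:
  assumes "0 < r"
  shows "0 < conv exp_kernel (indicat_real {- r..r}) x"
proof -
  have "0 < r * exp (- r - \<bar>x\<bar>)" using assms by simp
  also have "\<dots> = (LINT y|lborel. exp (- r - \<bar>x\<bar>) / 2 * indicat_real {- r..r} y)"
    using assms by simp
  also have "\<dots> \<le> conv exp_kernel (indicat_real {- r..r}) x"
    unfolding conv_def
  proof (rule integral_mono)
    show "integrable lborel (\<lambda>y. exp (- r - \<bar>x\<bar>) / 2 * indicat_real {- r..r} y)"
      by (intro integrable_mult_right integrable_indicator_Icc)
    show "integrable lborel (\<lambda>y. exp_kernel (x - y) * indicat_real {- r..r} y)"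
      by (intro conv_integrable_bounded[where B = 1]) (auto simp: indicator_def)
    show "exp (- r - \<bar>x\<bar>) / 2 * indicat_real {- r..r} y
        \<le> exp_kernel (x - y) * indicat_real {- r..r} y" for y
      by (auto simp: exp_kernel_def indicator_def)
  qed
  finally show ?thesis .
qed

section \<open>Discontinuous ground states\<close>

lemma expand_of_deriv:
  fixes g g' :: "real \<Rightarrow> real"
  assumes "\<And>x. (g has_real_derivative g' x) (at x)"
    and "\<And>x. p \<le> x \<Longrightarrow> x \<le> q \<Longrightarrow> \<kappa> \<le> g' x"
    and "p \<le> x" "x \<le> y" "y \<le> q"
  shows "\<kappa> * (y - x) \<le> g y - g x"
proof (cases "x = y")
  case False
  then have "\<exists>z>x. z < y \<and> g y - g x = (y - x) * g' z"
    using assms by (intro MVT2) auto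
  then obtain z where "x < z" "z < y" "g y - g x = (y - x) * g' z" by blast
  moreover have "(y - x) * \<kappa> \<le> (y - x) * g' z"
    using assms calculation by (intro mult_left_mono) auto
  ultimately show ?thesis by (simp add: mult.commute)
qed simp

text \<open>Expansion makes \<open>g\<close> injective and forces
  \<open>g (p + r) \<ge> \<kappa> * r\<close>, so the values in \<open>[0, \<kappa> r]\<close> are
  attained by the intermediate value theorem. Comparing with \<open>g p = 0\<close> bounds the
  inverse linearly with slope \<open>1 / \<kappa>\<close>.\<close>

lemma local_inverse:
  fixes g :: "real \<Rightarrow> real"
  assumes "0 < \<kappa>" "0 < r" and cont: "continuous_on {p..p + r} g" and "g p = 0"
    and expand: "\<And>x y. p \<le> x \<Longrightarrow> x \<le> y \<Longrightarrow> y \<le> p + r \<Longrightarrow> \<kappa> * (y - x) \<le> g y - g x"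
  obtains h where "continuous_on UNIV h" "mono h" "\<And>s. h s \<in> {p..p + r}"
    "\<And>s. 0 \<le> s \<Longrightarrow> s \<le> \<kappa> * r \<Longrightarrow> g (h s) = s"
    "\<And>s. 0 \<le> s \<Longrightarrow> s \<le> \<kappa> * r \<Longrightarrow> h s \<le> p + s / \<kappa>"
proof -
  let ?I = "{p..p + r}"
  \<comment> \<open>Clamping the argument extends the inverse to a continuous monotone function on
    the whole line, with values still in \<open>?I\<close>.\<close>
  let ?c = "\<lambda>s. max 0 (min (\<kappa> * r) s)"
  have inj: "inj_on g ?I"
  proof (rule linorder_inj_onI')
    fix x y assume "x \<in> ?I" "y \<in> ?I" "x < y"
    with expand[of x y] mult_pos_pos[OF \<open>0 < \<kappa>\<close>, of "y - x"] show "g x \<noteq> g y" by auto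
  qed
  have range: "{0..\<kappa> * r} \<subseteq> g ` ?I"
  proof
    fix s assume s: "s \<in> {0..\<kappa> * r}"
    have "\<exists>x\<ge>p. x \<le> p + r \<and> g x = s"
      by (rule IVT') (use s assms expand[of p "p + r"] in auto)
    then show "s \<in> g ` ?I" by auto
  qed
  define k where "k = inv_into ?I g"
  have gk: "g (k s) = s" and k: "k s \<in> ?I" if "0 \<le> s" "s \<le> \<kappa> * r" for s
  proof -
    from that range have "s \<in> g ` ?I" by auto
    then show "g (k s) = s" "k s \<in> ?I" unfolding k_def by (rule f_inv_into_f, rule inv_into_into)
  qed
  have kcont: "continuous_on {0..\<kappa> * r} k"
  proof (rule continuous_on_subset[OF _ range])
    show "continuous_on (g ` ?I) k"
      by (rule continuous_on_inv[OF cont]) (auto simp: k_def inj)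
  qed
  have c: "0 \<le> ?c s" "?c s \<le> \<kappa> * r" for s using assms by auto
  have kmono: "k s \<le> k t" if "0 \<le> s" "s \<le> t" "t \<le> \<kappa> * r" for s t
  proof (rule ccontr)
    assume "\<not> k s \<le> k t"
    then have "\<kappa> * (k s - k t) \<le> g (k s) - g (k t)" and "k t < k s"
      using expand[of "k t" "k s"] k[of s] k[of t] that by auto
    then show False using gk[of s] gk[of t] that mult_pos_pos[OF \<open>0 < \<kappa>\<close>, of "k s - k t"] by auto
  qed
  show thesis
  proof (rule that[of "\<lambda>s. k (?c s)"])
    show "continuous_on UNIV (\<lambda>s. k (?c s))"
      by (rule continuous_on_compose2[OF kcont]) (use c in \<open>auto intro!: continuous_intros\<close>)
    show "mono (\<lambda>s. k (?c s))"
      by (rule monoI, rule kmono) (use c in \<open>auto simp: le_max_iff_disj min_le_iff_disj\<close>)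
    show "k (?c s) \<in> ?I" for s using k c by blast
    fix s :: real assume s: "0 \<le> s" "s \<le> \<kappa> * r"
    then have cs: "?c s = s" by auto
    show "g (k (?c s)) = s" using cs gk s by simp
    have "\<kappa> * (k s - p) \<le> s"
      using expand[of p "k s"] k[of s] gk[of s] s assms by auto
    then show "k (?c s) \<le> p + s / \<kappa>"
      unfolding cs using \<open>0 < \<kappa>\<close> by (simp add: field_simps)
  qed
qed

text \<open>The weight \<open>exp (- \<mu> \<bar>x\<bar>)\<close> gives the iterates an integrable majorant which the iteration
  reproduces, because the kernel decays faster than the weight.\<close>

lemma branch_fixed_point:
  fixes hp hm :: "real \<Rightarrow> real"
  defines "H \<equiv> \<lambda>x0 x. if \<bar>x\<bar> \<le> x0 then hp else hm"
  assumes hp: "continuous_on UNIV hp" "mono hp" "\<And>s. b \<le> hp s"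
      "\<And>s. 0 \<le> s \<Longrightarrow> s \<le> \<kappa> * r \<Longrightarrow> hp s \<le> b + s / \<kappa>"
    and hm: "continuous_on UNIV hm" "mono hm" "\<And>s. 0 \<le> hm s"
      "\<And>s. 0 \<le> s \<Longrightarrow> s \<le> \<kappa> * r \<Longrightarrow> hm s \<le> s / \<kappa>"
    and pos: "0 < \<kappa>" "0 < r" "0 < b" "0 < x0" "0 < \<mu>" "\<mu> < 1"
    and small: "b * x0 * exp x0 + r / (1 - \<mu>) \<le> \<kappa> * r"
  obtains U where "U \<in> borel_measurable lborel" "\<And>x. U (- x) = U x" "\<And>x. 0 \<le> U x"
    "\<And>x. U x \<le> b * indicat_real {- x0..x0} x + r * exp (- \<mu> * \<bar>x\<bar>)"
    "\<And>x. U x = H x0 x (conv exp_kernel U x)"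
    "\<And>x. 0 \<le> conv exp_kernel U x" "\<And>x. conv exp_kernel U x \<le> \<kappa> * r"
proof -
  let ?W = "\<lambda>x. b * indicat_real {- x0..x0} x + r * exp (- \<mu> * \<bar>x\<bar>)"
  let ?T = "\<lambda>V x. H x0 x (conv exp_kernel V x)"
  \<comment> \<open>The order interval that the iteration preserves: \<open>convW\<close> bounds the
    convolution of its members by \<open>\<kappa> * r * exp (- \<mu> * \<bar>x\<bar>)\<close>, and
    the slope \<open>1 / \<kappa>\<close> of the branch bounds brings this back below
    \<open>?W\<close>.\<close>
  define adm where "adm V \<longleftrightarrow> V \<in> borel_measurable lborel \<and> (\<forall>x. V (- x) = V x) \<and>
    (\<forall>x. 0 \<le> V x \<and> V x \<le> ?W x)" for V :: "real \<Rightarrow> real"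
  have W: "integrable lborel ?W"
    using pos by (intro Bochner_Integration.integrable_add integrable_mult_right
        integrable_indicator_Icc integrable_exp_abs)
  have int: "integrable lborel V" if "adm V" for V
    by (rule Bochner_Integration.integrable_bound[OF W])
      (use that in \<open>auto simp: adm_def intro!: AE_I2 intro: order_trans[OF _ abs_ge_self]\<close>)
  have convW: "conv exp_kernel ?W x \<le> \<kappa> * r * exp (- \<mu> * \<bar>x\<bar>)" for x
  proof -
    have i1: "integrable lborel (\<lambda>y. exp_kernel (x - y) * indicat_real {- x0..x0} y)"
      by (intro conv_integrable_bounded[where B = 1]) (auto simp: indicator_def)
    have i2: "integrable lborel (\<lambda>y. exp_kernel (x - y) * exp (- \<mu> * \<bar>y\<bar>))"
      using pos by (intro conv_integrable_bounded[where B = 1]) auto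
    have "conv exp_kernel ?W x
        = b * conv exp_kernel (indicat_real {- x0..x0}) x + r * conv exp_kernel (\<lambda>y. exp (- \<mu> * \<bar>y\<bar>)) x"
    proof -
      have "(\<lambda>y. exp_kernel (x - y) * ?W y) = (\<lambda>y. b * (exp_kernel (x - y) * indicat_real {- x0..x0} y)
          + r * (exp_kernel (x - y) * exp (- \<mu> * \<bar>y\<bar>)))"
        by (simp add: fun_eq_iff algebra_simps)
      then show ?thesis
        unfolding conv_def
        by (simp only:) (subst Bochner_Integration.integral_add,
          use i1 i2 in \<open>auto simp only: integral_mult_right_zero intro!: integrable_mult_right\<close>)
    qed
    also have "\<dots> \<le> b * (x0 * exp x0 * exp (- \<bar>x\<bar>)) + r * (exp (- \<mu> * \<bar>x\<bar>) / (1 - \<mu>))"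
      using conv_indicator[of x0 x] conv_exp_weight[of \<mu> x] pos
      by (intro add_mono mult_left_mono) auto
    also have "\<dots> \<le> b * (x0 * exp x0 * exp (- \<mu> * \<bar>x\<bar>)) + r * (exp (- \<mu> * \<bar>x\<bar>) / (1 - \<mu>))"
      using pos by (intro add_mono mult_left_mono) (auto intro: mult_left_le_one_le)
    also have "\<dots> = (b * x0 * exp x0 + r / (1 - \<mu>)) * exp (- \<mu> * \<bar>x\<bar>)"
      by (simp add: algebra_simps)
    also have "\<dots> \<le> \<kappa> * r * exp (- \<mu> * \<bar>x\<bar>)"
      using small by (intro mult_right_mono) auto
    finally show ?thesis .
  qed
  have conv0: "0 \<le> conv exp_kernel V x" if "adm V" for V x
    using that exp_kernel_nonneg unfolding conv_def adm_def
    by (intro Bochner_Integration.integral_nonneg) auto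
  have convV: "conv exp_kernel V x \<le> \<kappa> * r * exp (- \<mu> * \<bar>x\<bar>)" if "adm V" for V x
  proof -
    have "conv exp_kernel V x \<le> conv exp_kernel ?W x"
      using that by (intro conv_mono conv_integrable_L1 int W) (auto simp: adm_def)
    with convW show ?thesis by (rule order_trans[rotated])
  qed
  have convV': "conv exp_kernel V x \<le> \<kappa> * r" if "adm V" for V x
  proof -
    have "\<kappa> * r * exp (- \<mu> * \<bar>x\<bar>) \<le> \<kappa> * r" using pos by (intro mult_left_le) auto
    with convV[OF that, of x] show ?thesis by simp
  qed
  have step: "adm (?T V)" if V: "adm V" for V
    unfolding adm_def
  proof (intro conjI allI)
    have [measurable]: "hp \<in> borel_measurable borel" "hm \<in> borel_measurable borel"
      "conv exp_kernel V \<in> borel_measurable borel"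
      using hp(1) hm(1) continuous_conv[OF int[OF V]] by (auto intro: borel_measurable_continuous_onI)
    have "?T V = (\<lambda>x. if \<bar>x\<bar> \<le> x0 then hp (conv exp_kernel V x) else hm (conv exp_kernel V x))"
      by (auto simp: H_def)
    then show "?T V \<in> borel_measurable lborel" by simp
    fix x
    show "?T V (- x) = ?T V x"
      using V by (simp add: H_def conv_even adm_def)
    let ?v = "conv exp_kernel V x"
    have v: "?v / \<kappa> \<le> r * exp (- \<mu> * \<bar>x\<bar>)"
      using convV[OF V, of x] pos by (simp add: field_simps)
    show "0 \<le> ?T V x" using hm(3)[of ?v] hp(3)[of ?v] pos by (simp add: H_def)
    show "?T V x \<le> ?W x"
      using hp(4)[of ?v] hm(4)[of ?v] v conv0[OF V, of x] convV'[OF V, of x] by (auto simp: H_def indicator_def abs_le_iff)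
  qed
  \<comment> \<open>Since \<open>0\<close> is the least admissible function and kernel and branches
    are monotone, the iterates increase. They stay below \<open>?W\<close>, hence converge
    pointwise.\<close>
  define X where "X n = (?T ^^ n) (\<lambda>_. 0)" for n
  have X0: "X 0 = (\<lambda>_. 0)" and XS: "X (Suc n) = ?T (X n)" for n by (auto simp: X_def)
  have adm: "adm (X n)" for n
  proof (induction n)
    case 0
    then show ?case using pos by (auto simp: X0 adm_def)
  next
    case (Suc n)
    then show ?case unfolding XS by (rule step)
  qed
  have le: "X n x \<le> X (Suc n) x" for n x
  proof (induction n arbitrary: x)
    case 0
    then show ?case using adm[of 1] by (auto simp: X0 adm_def)
  next
    case (Suc n)
    have "conv exp_kernel (X n) x \<le> conv exp_kernel (X (Suc n)) x"
      using Suc by (intro conv_mono conv_integrable_L1 int adm) auto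
    then show ?case unfolding XS[of n] XS[of "Suc n"] H_def
      using hp(2) hm(2) by (auto dest: monoD)
  qed
  have lim: "\<exists>L. (\<lambda>n. X n x) \<longlonglongrightarrow> L" for x
  proof (rule incseq_convergent)
    show "incseq (\<lambda>n. X n x)" using le by (intro incseq_SucI)
    show "\<forall>i. X i x \<le> ?W x" using adm by (auto simp: adm_def)
  qed blast
  then obtain U where U: "\<And>x. (\<lambda>n. X n x) \<longlonglongrightarrow> U x" by metis
  have admU: "adm U"
    unfolding adm_def
  proof (intro conjI allI)
    show "U \<in> borel_measurable lborel"
      by (rule borel_measurable_LIMSEQ_real[OF U]) (use adm in \<open>auto simp: adm_def\<close>)
    fix x
    have "(\<lambda>n. X n (- x)) = (\<lambda>n. X n x)" using adm by (auto simp: adm_def)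
    with U[of x] U[of "- x"] show "U (- x) = U x" by (auto intro: LIMSEQ_unique)
    show "0 \<le> U x" by (rule LIMSEQ_le_const[OF U]) (use adm in \<open>auto simp: adm_def\<close>)
    show "U x \<le> ?W x" by (rule LIMSEQ_le_const2[OF U]) (use adm in \<open>auto simp: adm_def\<close>)
  qed
  have fixU: "U x = ?T U x" for x
  proof -
    have "(\<lambda>n. conv exp_kernel (X n) x) \<longlonglongrightarrow> conv exp_kernel U x"
      unfolding conv_def
    proof (rule integral_dominated_convergence)
      show "integrable lborel (\<lambda>y. exp_kernel (x - y) * ?W y)" by (rule conv_integrable_L1[OF W])
      show "AE y in lborel. (\<lambda>n. exp_kernel (x - y) * X n y) \<longlonglongrightarrow> exp_kernel (x - y) * U y"
        using U by (intro AE_I2 tendsto_mult_left)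
      show "AE y in lborel. norm (exp_kernel (x - y) * X n y) \<le> exp_kernel (x - y) * ?W y" for n
        using adm[of n] exp_kernel_nonneg
        by (intro AE_I2) (auto simp: adm_def abs_mult intro!: mult_left_mono)
      show "(\<lambda>y. exp_kernel (x - y) * U y) \<in> borel_measurable lborel"
        using conv_integrable_L1[OF int[OF admU]] by (rule borel_measurable_integrable)
      show "(\<lambda>y. exp_kernel (x - y) * X n y) \<in> borel_measurable lborel" for n
        using conv_integrable_L1[OF int[OF adm]] by (rule borel_measurable_integrable)
    qed
    \<comment> \<open>The branch depends on \<open>x\<close> alone and not on the iterate, so at
      fixed \<open>x\<close> the limit passes through one continuous function.\<close>
    moreover have "isCont (H x0 x) (conv exp_kernel U x)"
      using hp(1) hm(1) by (simp add: H_def continuous_on_eq_continuous_at)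
    ultimately have "(\<lambda>n. X (Suc n) x) \<longlonglongrightarrow> ?T U x"
      unfolding XS by (rule isCont_tendsto_compose[rotated])
    with LIMSEQ_Suc[OF U[of x]] show ?thesis by (rule LIMSEQ_unique)
  qed
  show thesis
    by (rule that[of U]) (use admU fixU conv0[OF admU] convV'[OF admU] in \<open>auto simp: adm_def\<close>)
qed

text \<open>Applying \<open>g\<close> to the fixed point equation gives
  \<open>g (U x) = conv exp_kernel U x\<close>, which is the stationary equation. \<open>U\<close>
  is continuous off the switching points because the convolution is continuous, and it jumps at
  \<open>x0\<close> because its value there is at least \<open>b\<close> while values to the right
  are at most \<open>r < b\<close>.\<close>

lemma ground_state_of_branches:
  fixes hp hm g f :: "real \<Rightarrow> real"
  assumes hp: "continuous_on UNIV hp" "\<And>s. b \<le> hp s"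
      "\<And>s. 0 \<le> s \<Longrightarrow> s \<le> \<kappa> * r \<Longrightarrow> g (hp s) = s"
    and hm: "continuous_on UNIV hm" "\<And>s. hm s \<in> {0..r}"
      "\<And>s. 0 \<le> s \<Longrightarrow> s \<le> \<kappa> * r \<Longrightarrow> g (hm s) = s"
    and pos: "0 < d" "0 < r" "r < b" "0 < x0" "0 < \<mu>"
    and g: "g = (\<lambda>u. u - f u / d)" "g 0 = 0"
    and U: "U \<in> borel_measurable lborel" "\<And>x. U (- x) = U x" "\<And>x. 0 \<le> U x"
      "\<And>x. U x \<le> b * indicat_real {- x0..x0} x + r * exp (- \<mu> * \<bar>x\<bar>)"
    and fixpoint: "\<And>x. U x = (if \<bar>x\<bar> \<le> x0 then hp else hm) (conv exp_kernel U x)"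
    and range: "\<And>x. 0 \<le> conv exp_kernel U x" "\<And>x. conv exp_kernel U x \<le> \<kappa> * r"
  shows "ground_state exp_kernel d f U" and "{x. \<not> isCont U x} = {x0, - x0}"
    and "\<And>x. g (U x) = conv exp_kernel U x"
proof -
  let ?v = "conv exp_kernel U"
  let ?W = "\<lambda>x. b * indicat_real {- x0..x0} x + r * exp (- \<mu> * \<bar>x\<bar>)"
  show gU: "g (U x) = ?v x" for x
    using fixpoint[of x] hp(3) hm(3) range[of x] by (auto split: if_splits)
  have bd: "U x \<le> b + r" for x
  proof -
    have "?W x \<le> b * 1 + r * 1"
      using pos by (intro add_mono mult_left_mono) (auto simp: indicator_def)
    with U(4)[of x] show ?thesis by simp
  qed
  have intU: "integrable lborel U"
  proof (rule Bochner_Integration.integrable_bound)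
    show "integrable lborel ?W"
      using pos by (intro Bochner_Integration.integrable_add integrable_mult_right
          integrable_indicator_Icc integrable_exp_abs)
    show "AE x in lborel. norm (U x) \<le> norm (?W x)"
    proof (intro AE_I2)
      show "norm (U x) \<le> norm (?W x)" for x using U(3,4)[of x] by simp
    qed
  qed (rule U)
  \<comment> \<open>\<open>U\<close> is at least \<open>b\<close> on the plateau, and the kernel is
    positive everywhere.\<close>
  have vpos: "0 < ?v x" for x
  proof -
    have "0 < b * conv exp_kernel (indicat_real {- x0..x0}) x"
      using conv_indicator_pos[of x0 x] pos by simp
    also have "\<dots> = conv exp_kernel (\<lambda>y. b * indicat_real {- x0..x0} y) x"
      by (simp add: conv_def mult.left_commute)
    also have "\<dots> \<le> ?v x"
    proof (rule conv_mono)
      show "integrable lborel (\<lambda>y. exp_kernel (x - y) * (b * indicat_real {- x0..x0} y))"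
        using pos by (intro conv_integrable_bounded[where B = b]) (auto simp: indicator_def)
      show "integrable lborel (\<lambda>y. exp_kernel (x - y) * U y)" by (rule conv_integrable_L1[OF intU])
      show "AE y in lborel. b * indicat_real {- x0..x0} y \<le> U y"
      proof (intro AE_I2)
        show "b * indicat_real {- x0..x0} y \<le> U y" for y
          using fixpoint[of y] hp(2) U(3)[of y] by (auto simp: indicator_def abs_le_iff)
      qed
    qed
    finally show ?thesis .
  qed
  \<comment> \<open>A zero of \<open>U\<close> would give \<open>g (U x) = g 0 = 0\<close>, against
    \<open>vpos\<close>.\<close>
  have Upos: "0 < U x" for x
    using gU[of x] vpos[of x] g(2) U(3)[of x] by (cases "U x = 0") auto
  have tail: "(U \<longlongrightarrow> 0) F" if F: "filterlim (\<lambda>x::real. \<bar>x\<bar>) at_top F" for F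
  proof (rule tendsto_sandwich[where f = "\<lambda>_. 0" and h = "\<lambda>x. r * exp (- \<mu> * \<bar>x\<bar>)"])
    have "filterlim (\<lambda>x. \<mu> * \<bar>x\<bar>) at_top F"
      using filterlim_tendsto_pos_mult_at_top[OF tendsto_const pos(5) F] by simp
    then have "((\<lambda>x. exp (- (\<mu> * \<bar>x\<bar>))) \<longlongrightarrow> 0) F"
      by (intro filterlim_compose[OF exp_at_bot] filterlim_compose[OF filterlim_uminus_at_bot_at_top])
    from tendsto_mult_right_zero[OF this, of r]
    show "((\<lambda>x. r * exp (- \<mu> * \<bar>x\<bar>)) \<longlongrightarrow> 0) F" by simp
    have "\<forall>\<^sub>F x in F. x0 < \<bar>x\<bar>" using F by (simp add: filterlim_at_top_dense)
    then show "\<forall>\<^sub>F x in F. U x \<le> r * exp (- \<mu> * \<bar>x\<bar>)"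
    proof eventually_elim
      case (elim x)
      then have "x \<notin> {- x0..x0}" by auto
      then show ?case using U(4)[of x] by simp
    qed
  qed (use U(3) in auto)
  show "ground_state exp_kernel d f U"
    unfolding ground_state_def
  proof (intro conjI allI)
    show "bounded (range U)"
      using bd U(3) by (intro boundedI[where B = "b + r"]) auto
    show "integrable lborel (\<lambda>x. (U x)\<^sup>2)"
    proof (rule Bochner_Integration.integrable_bound)
      show "integrable lborel (\<lambda>x. (b + r) * U x)" using intU by (rule integrable_mult_right)
      show "AE x in lborel. norm ((U x)\<^sup>2) \<le> norm ((b + r) * U x)"
      proof (intro AE_I2)
        show "norm ((U x)\<^sup>2) \<le> norm ((b + r) * U x)" for x
          using mult_right_mono[OF bd[of x] U(3)[of x]] U(3)[of x] pos
          by (simp add: power2_eq_square abs_mult)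
      qed
    qed (use U(1) in measurable)
    show "0 = d * (- U x + ?v x) + f (U x)" for x
      using gU[of x] pos(1) unfolding g(1) by (simp add: field_simps)
    show "(U \<longlongrightarrow> 0) at_top" by (rule tail[OF filterlim_abs_real])
    show "(U \<longlongrightarrow> 0) at_bot"
      by (rule tail)
        (use filterlim_compose[OF filterlim_abs_real filterlim_uminus_at_top_at_bot] in simp)
  qed (use U Upos in auto)
  have vcont: "continuous_on S ?v" for S
    using continuous_conv[OF intU] by (rule continuous_on_subset) auto
  have "isCont U x" if "x \<noteq> x0" "x \<noteq> - x0" for x
  proof (cases "\<bar>x\<bar> < x0")
    case True
    have "continuous_on {- x0<..<x0} U \<longleftrightarrow> continuous_on {- x0<..<x0} (\<lambda>x. hp (?v x))"
      by (rule continuous_on_cong) (auto simp: fixpoint[of x for x])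
    also have "\<dots>" by (rule continuous_on_compose2[OF hp(1) vcont]) auto
    finally show ?thesis using True by (simp add: continuous_on_eq_continuous_at abs_less_iff)
  next
    case False
    let ?S = "- {- x0..x0}"
    have "continuous_on ?S U \<longleftrightarrow> continuous_on ?S (\<lambda>x. hm (?v x))"
      by (rule continuous_on_cong) (auto simp: fixpoint[of x for x])
    also have "\<dots>" by (rule continuous_on_compose2[OF hm(1) vcont]) auto
    finally have "continuous_on ?S U" .
    moreover have "x \<in> ?S" "open ?S" using False that by auto
    ultimately show ?thesis by (simp add: continuous_on_eq_continuous_at)
  qed
  moreover have jump: "\<not> isCont U x0"
  proof
    assume "isCont U x0"
    then have "(U \<longlongrightarrow> U x0) (at_right x0)"
      by (simp add: isCont_def filterlim_at_split)
    moreover have "\<forall>\<^sub>F x in at_right x0. U x \<le> r"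
      using eventually_at_right_less[of x0]
    proof eventually_elim
      case (elim x)
      then show ?case using fixpoint[of x] hm(2)[of "?v x"] pos by auto
    qed
    ultimately have "U x0 \<le> r" by (rule tendsto_upperbound) simp
    moreover have "b \<le> U x0" using fixpoint[of x0] hp(2) pos by auto
    ultimately show False using pos by simp
  qed
  moreover have "\<not> isCont U (- x0)"
  proof
    assume "isCont U (- x0)"
    then have "isCont (\<lambda>x. U (- x)) x0" by (rule isCont_o2[rotated]) auto
    then show False using jump U(2) by simp
  qed
  ultimately show "{x. \<not> isCont U x} = {x0, - x0}" by auto
qed

section \<open>Lower bounds for the Cauchy problem\<close>

text \<open>To become negative, \<open>z\<close> would have to descend through the strip
  \<open>(- \<epsilon>, 0)\<close>, where it cannot decrease. The sign condition is confined to a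
  strip because the sign information on \<open>f\<close> and \<open>g\<close> is local.\<close>

lemma barrier:
  fixes z z' :: "real \<Rightarrow> real"
  assumes cont: "continuous_on {s..} z" and "0 \<le> z s" and "0 < \<epsilon>"
    and der: "\<And>t. s < t \<Longrightarrow> t \<le> T \<Longrightarrow> (z has_real_derivative z' t) (at t)"
    and neg: "\<And>t. s < t \<Longrightarrow> t \<le> T \<Longrightarrow> - \<epsilon> < z t \<Longrightarrow> z t < 0 \<Longrightarrow> 0 \<le> z' t"
    and "s \<le> t" "t \<le> T"
  shows "0 \<le> z t"
proof (rule ccontr)
  assume "\<not> 0 \<le> z t"
  then have zt: "z t < 0" by simp
  have c: "continuous_on {s..t} z"
    using cont by (rule continuous_on_subset) auto
  \<comment> \<open>The possibly very negative \<open>z t\<close> is replaced by a value inside the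
    strip; the level \<open>- \<epsilon> / 2\<close> is attained on the way if \<open>z t\<close>
    lies below it.\<close>
  obtain t1 where t1: "s \<le> t1" "t1 \<le> t" "z t1 < 0" "- \<epsilon> < z t1"
  proof -
    have "\<exists>y\<ge>s. y \<le> t \<and> z y = max (z t) (- \<epsilon> / 2)"
      by (rule IVT2') (use zt assms c in auto)
    then obtain y where "s \<le> y" "y \<le> t" "z y = max (z t) (- \<epsilon> / 2)" by blast
    then show thesis using that[of y] zt \<open>0 < \<epsilon>\<close> by (simp add: max_def)
  qed
  have c1: "continuous_on {s..t1} z"
    using cont by (rule continuous_on_subset) auto
  \<comment> \<open>The least element \<open>t2\<close> of this set is the first time at which the
    level \<open>z t1\<close> is reached; before it, \<open>z\<close> lies strictly above that
    level.\<close>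
  let ?S = "{y \<in> {s..t1}. z y = z t1}"
  have "compact ?S"
  proof -
    have "closed ({s..t1} \<inter> z -` {z t1})"
      by (rule continuous_closed_preimage[OF c1]) auto
    moreover have "{s..t1} \<inter> z -` {z t1} = ?S" by auto
    ultimately show ?thesis
      by (auto simp: compact_eq_bounded_closed intro: bounded_subset[OF bounded_closed_interval])
  qed
  moreover have "?S \<noteq> {}" using t1 by auto
  ultimately obtain t2 where t2: "t2 \<in> ?S" "\<And>y. y \<in> ?S \<Longrightarrow> t2 \<le> y"
    by (meson compact_attains_inf)
  have st2: "s < t2" using t2(1) t1 \<open>0 \<le> z s\<close> by (cases "s = t2") auto
  have above: "z t1 < z y" if "s \<le> y" "y < t2" for y
  proof (rule ccontr)
    assume n: "\<not> z t1 < z y"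
    have "\<exists>x\<ge>s. x \<le> y \<and> z x = z t1"
      by (rule IVT2') (use n that t1 t2 \<open>0 \<le> z s\<close> in \<open>auto intro!: continuous_on_subset[OF cont]\<close>)
    then obtain x where "s \<le> x" "x \<le> y" "z x = z t1" by blast
    with t2(2)[of x] that t2(1) show False by auto
  qed
  text \<open>Just before \<open>t2\<close> the function takes values in \<open>(z t1, 0)\<close>, where it cannot decrease.\<close>
  have "\<forall>\<^sub>F y in at_left t2. z y < 0"
  proof (rule order_tendstoD)
    have "t2 \<le> T" using t2(1) t1 assms(7) by auto
    then have "isCont z t2" using der[OF st2] by (auto intro: DERIV_isCont)
    then show "(z \<longlongrightarrow> z t2) (at_left t2)"
      by (simp add: isCont_def filterlim_at_split)
    show "z t2 < 0" using t2 t1 by auto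
  qed
  then obtain q where q: "q < t2" "\<And>y. q < y \<Longrightarrow> y < t2 \<Longrightarrow> z y < 0"
    using eventually_at_left[OF st2] by auto
  define r where "r = (max q s + t2) / 2"
  have r: "q < r" "s < r" "r < t2" using q st2 by (auto simp: r_def)
  have "\<exists>\<xi>. r < \<xi> \<and> \<xi> < t2 \<and> z t2 - z r = (t2 - r) * z' \<xi>"
    by (rule MVT2) (use r t2(1) t1 assms(7) in \<open>auto intro!: der\<close>)
  then obtain \<xi> where \<xi>: "r < \<xi>" "\<xi> < t2" "z t2 - z r = (t2 - r) * z' \<xi>" by blast
  have "0 \<le> z' \<xi>"
    using \<xi> r q(2)[of \<xi>] above[of \<xi>] t2(1) t1 assms(7) by (intro neg) auto
  then have "z t2 \<ge> z r" using \<xi>(3) r mult_nonneg_nonneg[of "t2 - r" "z' \<xi>"] by linarith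
  moreover have "z r > z t1" using above[of r] r by simp
  ultimately show False using t2(1) by auto
qed

text \<open>The norm dominates the essential supremum, so continuity in time is uniform in
  \<open>x\<close> up to null sets, which may depend on \<open>t\<close>.\<close>

lemma C0_AE_close:
  assumes "C0_L1_Linf {0..} u" "0 \<le> T" "0 < \<eta>"
  obtains \<tau> where "0 < \<tau>" "\<And>t. T \<le> t \<Longrightarrow> t \<le> T + \<tau> \<Longrightarrow> AE x in lborel. \<bar>u t x - u T x\<bar> < \<eta>"
proof -
  have "((\<lambda>s. norm_L1_Linf (\<lambda>x. u s x - u T x)) \<longlongrightarrow> 0) (at T within {0..})"
    using assms by (auto simp: C0_L1_Linf_def)
  then have "\<forall>\<^sub>F s in at T within {0..}. norm_L1_Linf (\<lambda>x. u s x - u T x) < ereal \<eta>"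
    using assms by (intro order_tendstoD) (auto simp: zero_ereal_def)
  then obtain \<delta> where \<delta>: "0 < \<delta>"
    "\<And>s. s \<in> {0..} \<Longrightarrow> s \<noteq> T \<Longrightarrow> dist s T < \<delta> \<Longrightarrow> norm_L1_Linf (\<lambda>x. u s x - u T x) < ereal \<eta>"
    by (auto simp: eventually_at)
  show thesis
  proof (rule that[of "\<delta> / 2"])
    fix t assume t: "T \<le> t" "t \<le> T + \<delta> / 2"
    show "AE x in lborel. \<bar>u t x - u T x\<bar> < \<eta>"
    proof (cases "t = T")
      case True
      then show ?thesis using assms by simp
    next
      case False
      let ?w = "\<lambda>x. u t x - u T x"
      have "norm_L1_Linf ?w < ereal \<eta>"
        using \<delta> t False assms by (auto simp: dist_real_def)
      moreover have "esssup lborel (\<lambda>x. ereal \<bar>?w x\<bar>) \<le> norm_L1_Linf ?w"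
        unfolding norm_L1_Linf_def by (rule add_increasing) auto
      ultimately have "esssup lborel (\<lambda>x. ereal \<bar>?w x\<bar>) < ereal \<eta>" by (rule le_less_trans[rotated])
      then show ?thesis
        using esssup_AE[of "\<lambda>x. ereal \<bar>?w x\<bar>" lborel]
        by (auto elim!: eventually_mono dest: le_less_trans)
    qed
  qed (use \<delta> in auto)
qed

lemma cauchy_solution_derivative:
  assumes "cauchy_solution K d f u0 u" "0 < t"
  shows "((\<lambda>s. u s x) has_real_derivative d * (- u t x + conv K (u t) x) + f (u t x)) (at t)"
  using assms by (simp add: cauchy_solution_def)

lemma cauchy_solution_continuous:
  assumes "cauchy_solution K d f u0 u" "S \<subseteq> {0..}"
  shows "continuous_on S (\<lambda>t. u t x)"
  using assms by (auto simp: cauchy_solution_def intro: continuous_on_subset)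

lemma cauchy_solution_integrable:
  assumes "cauchy_solution K d f u0 u" "0 \<le> t"
  shows "integrable lborel (u t)"
  using assms by (auto simp: cauchy_solution_def C0_L1_Linf_def L1_Linf_def)

text \<open>On a short interval \<open>u \<ge> - \<eta>\<close> almost everywhere. A bound \<open>u \<ge> - c\<close> almost everywhere
  improves to \<open>u \<ge> - c \<theta>\<close> everywhere with a fixed \<open>\<theta> < 1\<close>.\<close>

lemma cauchy_solution_nonneg_step:
  assumes u: "cauchy_solution exp_kernel d f u0 u" and "0 < d" "0 < \<eta>"
    and f: "\<And>s. - \<eta> \<le> s \<Longrightarrow> s \<le> 0 \<Longrightarrow> 0 \<le> f s"
    and "0 \<le> T" and uT: "\<And>x. 0 \<le> u T x"
  obtains \<tau> where "0 < \<tau>" "\<And>t x. T \<le> t \<Longrightarrow> t \<le> T + \<tau> \<Longrightarrow> 0 \<le> u t x"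
proof -
  have "C0_L1_Linf {0..} u" using u by (simp add: cauchy_solution_def)
  then obtain \<tau> where \<tau>: "0 < \<tau>"
    "\<And>t. T \<le> t \<Longrightarrow> t \<le> T + \<tau> \<Longrightarrow> AE x in lborel. \<bar>u t x - u T x\<bar> < \<eta>"
    using C0_AE_close[OF _ \<open>0 \<le> T\<close> \<open>0 < \<eta>\<close>] by blast
  define \<theta> where "\<theta> = 1 - exp (- d * \<tau>)"
  have \<theta>: "0 < \<theta>" "\<theta> < 1" using \<tau> \<open>0 < d\<close> by (auto simp: \<theta>_def)
  have improve: "- (c * \<theta>) \<le> u t x"
    if c: "0 \<le> c" "c \<le> \<eta>" and t: "T \<le> t" "t \<le> T + \<tau>"
      and lower: "\<And>s. T \<le> s \<Longrightarrow> s \<le> T + \<tau> \<Longrightarrow> AE y in lborel. - c \<le> u s y" for c t x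
  proof -
    \<comment> \<open>The solution of \<open>\<phi>' = d (- c - \<phi>)\<close> with
      \<open>\<phi>(T) = 0\<close>, that is, the decay when the convolution takes its least possible
      value \<open>- c\<close>. Its value at \<open>T + \<tau>\<close> is
      \<open>- c * \<theta>\<close>.\<close>
    let ?\<phi> = "\<lambda>t. - c * (1 - exp (- d * (t - T)))"
    let ?z' = "\<lambda>t. d * (- u t x + conv exp_kernel (u t) x) + f (u t x) + c * (d * exp (- d * (t - T)))"
    have \<phi>: "- (c * \<theta>) \<le> ?\<phi> s" "?\<phi> s \<le> 0" if "T \<le> s" "s \<le> T + \<tau>" for s
      using c that \<open>0 < d\<close> by (auto simp: \<theta>_def intro!: mult_left_mono mult_nonneg_nonneg)
    \<comment> \<open>Makes the strip width \<open>\<eta> - c * \<theta>\<close> positive. In a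
      strip of this width below \<open>?\<phi>\<close>, \<open>u\<close> stays above
      \<open>- \<eta>\<close>, where \<open>f\<close> is known to be nonnegative.\<close>
    have "c * \<theta> < \<eta>"
    proof (cases "c = 0")
      case False
      then have "c * \<theta> < c * 1" using \<theta> c by (intro mult_strict_left_mono) auto
      then show ?thesis using c by simp
    qed (use \<open>0 < \<eta>\<close> in simp)
    have "0 \<le> u t x - ?\<phi> t"
    proof (rule barrier[where z = "\<lambda>t. u t x - ?\<phi> t" and s = T and T = "T + \<tau>" and z' = ?z'
          and \<epsilon> = "\<eta> - c * \<theta>"])
      show "continuous_on {T..} (\<lambda>t. u t x - ?\<phi> t)"
        using \<open>0 \<le> T\<close> by (intro continuous_intros cauchy_solution_continuous[OF u]) auto
      show "0 \<le> u T x - ?\<phi> T" using uT by simp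
      show "((\<lambda>t. u t x - ?\<phi> t) has_real_derivative ?z' s) (at s)" if "T < s" for s
        using that \<open>0 \<le> T\<close>
        by (auto intro!: derivative_eq_intros cauchy_solution_derivative[OF u])
      show "0 \<le> ?z' s" if s: "T < s" "s \<le> T + \<tau>"
        and "- (\<eta> - c * \<theta>) < u s x - ?\<phi> s" "u s x - ?\<phi> s < 0" for s
      proof -
        have "- c = conv exp_kernel (\<lambda>_. - c) x" by (simp add: conv_const)
        also have "\<dots> \<le> conv exp_kernel (u s) x"
          using s \<open>0 \<le> T\<close>
          by (intro conv_mono conv_integrable_bounded[where B = c] conv_integrable_L1
              cauchy_solution_integrable[OF u] lower) (use c in auto)
        finally have "- c \<le> conv exp_kernel (u s) x" .
        moreover have "0 \<le> f (u s x)" using \<phi>[of s] that by (intro f) auto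
        moreover have "?z' s = d * ((?\<phi> s - u s x) + (conv exp_kernel (u s) x + c)) + f (u s x)"
          by (simp add: algebra_simps)
        moreover have "0 \<le> d * ((?\<phi> s - u s x) + (conv exp_kernel (u s) x + c))"
          using that \<open>- c \<le> conv exp_kernel (u s) x\<close> \<open>0 < d\<close> by (intro mult_nonneg_nonneg) linarith+
        ultimately show ?thesis by linarith
      qed
    qed (use t \<open>c * \<theta> < \<eta>\<close> in auto)
    then show ?thesis using \<phi>(1)[OF t] by simp
  qed
  \<comment> \<open>The exponent starts at one: the initial bound \<open>- \<eta>\<close> holds
    almost everywhere, and the first improvement makes it hold at every \<open>x\<close>.\<close>
  have iter: "- (\<eta> * \<theta> ^ Suc n) \<le> u t x" if "T \<le> t" "t \<le> T + \<tau>" for n t x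
    using that
  proof (induction n arbitrary: t x)
    case 0
    have "AE y in lborel. - \<eta> \<le> u s y" if "T \<le> s" "s \<le> T + \<tau>" for s
      using \<tau>(2)[OF that]
    proof eventually_elim
      case (elim y)
      then show ?case using uT[of y] by linarith
    qed
    then show ?case using improve[of \<eta> t x] 0 \<open>0 < \<eta>\<close> by simp
  next
    case (Suc n)
    have "\<eta> * \<theta> ^ Suc n \<le> \<eta> * 1"
      using \<theta> \<open>0 < \<eta>\<close> by (intro mult_left_mono power_le_one) auto
    then have "- (\<eta> * \<theta> ^ Suc n * \<theta>) \<le> u t x"
      using Suc \<theta> \<open>0 < \<eta>\<close> by (intro improve) auto
    then show ?case by (simp add: mult_ac)
  qed
  have "0 \<le> u t x" if "T \<le> t" "t \<le> T + \<tau>" for t x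
  proof (rule LIMSEQ_le_const2)
    have "(\<lambda>n. \<theta> ^ Suc n) \<longlonglongrightarrow> 0" using \<theta> by (intro LIMSEQ_Suc LIMSEQ_power_zero) auto
    from tendsto_minus[OF tendsto_mult_right_zero[OF this, of \<eta>]]
    show "(\<lambda>n. - (\<eta> * \<theta> ^ Suc n)) \<longlonglongrightarrow> 0" by simp
    show "\<exists>N. \<forall>n\<ge>N. - (\<eta> * \<theta> ^ Suc n) \<le> u t x" using iter[OF that] by blast
  qed
  with \<tau>(1) show thesis by (rule that)
qed

text \<open>Continuation in time: nonnegativity persists at the supremum \<open>S\<close> of the
  good times by continuity at fixed \<open>x\<close>, and the previous lemma carries it beyond
  \<open>S\<close>.\<close>

lemma cauchy_solution_nonneg:
  assumes u: "cauchy_solution exp_kernel d f u0 u" and "0 < d" "0 < \<eta>"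
    and f: "\<And>s. - \<eta> \<le> s \<Longrightarrow> s \<le> 0 \<Longrightarrow> 0 \<le> f s"
    and u0: "\<And>x. 0 \<le> u0 x" and "0 \<le> t"
  shows "0 \<le> u t x"
proof (rule ccontr)
  assume neg: "\<not> 0 \<le> u t x"
  define A where "A = {T. 0 \<le> T \<and> (\<forall>s\<in>{0..T}. \<forall>x. 0 \<le> u s x)}"
  have A0: "0 \<in> A" using u u0 by (auto simp: A_def cauchy_solution_def)
  have bdd: "T \<le> t" if "T \<in> A" for T
    using that neg \<open>0 \<le> t\<close> by (fastforce simp: A_def)
  define S where "S = Sup A"
  have "bdd_above A" using bdd by (rule bdd_aboveI)
  have S0: "0 \<le> S" unfolding S_def using A0 \<open>bdd_above A\<close> by (rule cSup_upper)
  have below: "0 \<le> u s y" if s: "0 \<le> s" "s < S" for s y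
  proof -
    obtain T where "T \<in> A" "s < T"
      using s(2) A0 \<open>bdd_above A\<close> unfolding S_def using less_cSup_iff[of A s] by auto
    with s show ?thesis by (auto simp: A_def)
  qed
  have at: "0 \<le> u S y" for y
  proof (cases "S = 0")
    case True
    with A0 show ?thesis by (simp add: A_def)
  next
    case False
    then have cl: "closure {0..<S} = {0..S}" using S0 by (intro closure_atLeastLessThan) simp
    show ?thesis
      by (rule continuous_ge_on_closure[of "{0..<S}" "\<lambda>s. u s y"])
        (use cl S0 below in \<open>auto intro!: cauchy_solution_continuous[OF u]\<close>)
  qed
  obtain \<tau> where \<tau>: "0 < \<tau>" "\<And>t x. S \<le> t \<Longrightarrow> t \<le> S + \<tau> \<Longrightarrow> 0 \<le> u t x"
    using cauchy_solution_nonneg_step[OF u \<open>0 < d\<close> \<open>0 < \<eta>\<close> f S0 at] by blast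
  have "S + \<tau> \<in> A"
    unfolding A_def
  proof (intro CollectI conjI ballI allI)
    fix s y assume "s \<in> {0..S + \<tau>}"
    then show "0 \<le> u s y" using \<tau>(2)[of s y] below[of s y] by (cases "s < S") auto
  qed (use S0 \<tau> in simp)
  then have "S + \<tau> \<le> S" unfolding S_def using \<open>bdd_above A\<close> by (rule cSup_upper)
  with \<tau> show False by simp
qed

text \<open>Since \<open>u \<ge> 0\<close>, its convolution is nonnegative and the time derivative
  is at least \<open>- d * g (u t x)\<close>, which is nonnegative just below
  \<open>b\<close>.\<close>

lemma cauchy_solution_ge_plateau:
  assumes u: "cauchy_solution exp_kernel d f u0 u" and "0 < d" "0 < \<epsilon>"
    and g: "g = (\<lambda>u. u - f u / d)" "\<And>s. b - \<epsilon> < s \<Longrightarrow> s < b \<Longrightarrow> g s \<le> 0"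
    and nonneg: "\<And>t x. 0 \<le> t \<Longrightarrow> 0 \<le> u t x"
    and "b \<le> u 0 x" "0 \<le> t"
  shows "b \<le> u t x"
proof -
  let ?z' = "\<lambda>t. d * (- u t x + conv exp_kernel (u t) x) + f (u t x)"
  have "0 \<le> u t x - b"
  proof (rule barrier[where z = "\<lambda>t. u t x - b" and s = 0 and T = t and z' = ?z' and \<epsilon> = \<epsilon>])
    show "continuous_on {0..} (\<lambda>t. u t x - b)"
      by (intro continuous_intros cauchy_solution_continuous[OF u]) auto
    show "((\<lambda>t. u t x - b) has_real_derivative ?z' s) (at s)" if "0 < s" for s
      using that by (auto intro!: derivative_eq_intros cauchy_solution_derivative[OF u])
    show "0 \<le> ?z' s" if "0 < s" "- \<epsilon> < u s x - b" "u s x - b < 0" for s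
    proof -
      have "0 \<le> conv exp_kernel (u s) x"
        unfolding conv_def using nonneg that exp_kernel_nonneg
        by (intro Bochner_Integration.integral_nonneg) auto
      moreover have "g (u s x) \<le> 0" using that by (intro g) auto
      moreover have "?z' s = d * (conv exp_kernel (u s) x - g (u s x))"
        using \<open>0 < d\<close> by (simp add: g(1) field_simps)
      ultimately show ?thesis using \<open>0 < d\<close> by simp
    qed
  qed (use assms in auto)
  then show ?thesis by simp
qed

section \<open>Convergence from below\<close>

text \<open>Where \<open>U > u\<close>, the difference \<open>p = U - u\<close> satisfies
  \<open>p' = d (K * p - (g U - g u)) \<le> d (m - \<kappa> p)\<close> with \<open>m\<close> a bound for \<open>p\<close>. So after a fixed
  time \<open>S\<close>, the bound \<open>m\<close> has improved to \<open>m \<theta>\<close> for any \<open>\<theta> \<in> (1 / \<kappa>, 1)\<close>.\<close>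

lemma stationary_le_liminf:
  assumes u: "cauchy_solution exp_kernel d f u0 u" and "0 < d" "1 < \<kappa>"
    and g: "g = (\<lambda>u. u - f u / d)"
    and U: "U \<in> borel_measurable lborel" "\<And>x. \<bar>U x\<bar> \<le> B" "\<And>x. g (U x) = conv exp_kernel U x"
    and nonneg: "\<And>t x. 0 \<le> t \<Longrightarrow> 0 \<le> u t x"
    and expand: "\<And>t x. 0 \<le> t \<Longrightarrow> u t x < U x \<Longrightarrow> \<kappa> * (U x - u t x) \<le> g (U x) - g (u t x)"
  shows "le_liminf_uniformly_on A U u"
proof -
  \<comment> \<open>\<open>\<theta>\<close> is the midpoint of \<open>1 / \<kappa>\<close> and
    \<open>1\<close>. \<open>S\<close> is the time in which \<open>exp (- d * \<kappa> * t)\<close>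
    halves, so that the excess over the limit \<open>m / \<kappa>\<close> is halved in
    \<open>improve\<close>.\<close>
  define \<theta> where "\<theta> = (1 + 1 / \<kappa>) / 2"
  define S where "S = ln 2 / (d * \<kappa>)"
  have \<theta>: "0 < \<theta>" "\<theta> < 1" using \<open>1 < \<kappa>\<close> by (auto simp: \<theta>_def field_simps)
  have S: "0 < S" "d * \<kappa> * S = ln 2" using \<open>1 < \<kappa>\<close> \<open>0 < d\<close> by (auto simp: S_def)
  have B: "0 \<le> B" using U(2)[of 0] by linarith
  have improve: "U x - u t x \<le> m * \<theta>"
    if m: "0 \<le> m" and T: "0 \<le> T" "T + S \<le> t"
      and bound: "\<And>s y. T \<le> s \<Longrightarrow> U y - u s y \<le> m" for m T t x
  proof -
    \<comment> \<open>The solution of \<open>\<phi>' = d (m - \<kappa> \<phi>)\<close> with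
      \<open>\<phi>(T) = m\<close>; it relaxes to \<open>m / \<kappa>\<close>.\<close>
    let ?\<phi> = "\<lambda>t. m / \<kappa> + (m - m / \<kappa>) * exp (- (d * \<kappa>) * (t - T))"
    let ?z' = "\<lambda>t. (m - m / \<kappa>) * (- (d * \<kappa>) * exp (- (d * \<kappa>) * (t - T)))
      + (d * (- u t x + conv exp_kernel (u t) x) + f (u t x))"
    have m\<kappa>: "m / \<kappa> \<le> m" using mult_right_mono[of 1 \<kappa> m] m \<open>1 < \<kappa>\<close> by (simp add: field_simps)
    have "0 \<le> ?\<phi> t - (U x - u t x)"
    proof (rule barrier[where z = "\<lambda>t. ?\<phi> t - (U x - u t x)" and s = T and T = t and z' = ?z'
          and \<epsilon> = 1])
      show "continuous_on {T..} (\<lambda>t. ?\<phi> t - (U x - u t x))"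
        using T by (intro continuous_intros cauchy_solution_continuous[OF u]) auto
      show "0 \<le> ?\<phi> T - (U x - u T x)" using bound[of T x] by simp
      show "((\<lambda>t. ?\<phi> t - (U x - u t x)) has_real_derivative ?z' s) (at s)" if "T < s" for s
        using that T by (auto intro!: derivative_eq_intros cauchy_solution_derivative[OF u])
      show "0 \<le> ?z' s" if s: "T < s" and neg: "?\<phi> s - (U x - u s x) < 0" for s
      proof -
        have i: "integrable lborel (\<lambda>y. exp_kernel (x - y) * U y)"
          "integrable lborel (\<lambda>y. exp_kernel (x - y) * u s y)"
          "integrable lborel (\<lambda>y. exp_kernel (x - y) * m)"
          using s T by (intro conv_integrable_bounded[OF U(1,2)] conv_integrable_L1
              cauchy_solution_integrable[OF u] integrable_mult_left exp_kernel_integrable; simp)+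
        have "conv exp_kernel U x - conv exp_kernel (u s) x = conv exp_kernel (\<lambda>y. U y - u s y) x"
          using i unfolding conv_def by (simp add: right_diff_distrib)
        also have "\<dots> \<le> conv exp_kernel (\<lambda>_. m) x"
          using i bound s by (intro conv_mono) (auto simp: right_diff_distrib)
        finally have c: "conv exp_kernel U x - conv exp_kernel (u s) x \<le> m" by (simp add: conv_const)
        \<comment> \<open>With \<open>neg\<close> this gives \<open>u s x < U x\<close>, the case in
          which the expansion of \<open>g\<close> is available.\<close>
        have "0 \<le> ?\<phi> s" using m m\<kappa> \<open>1 < \<kappa>\<close> by simp
        then have e: "\<kappa> * (U x - u s x) \<le> conv exp_kernel U x - g (u s x)"
          using neg expand[of s x] s T U(3)[of x] by simp
        have "?z' s = d * (\<kappa> * (U x - u s x - ?\<phi> s)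
          + (m - (conv exp_kernel U x - conv exp_kernel (u s) x))
          + (conv exp_kernel U x - g (u s x) - \<kappa> * (U x - u s x)))"
          using \<open>0 < d\<close> \<open>1 < \<kappa>\<close> unfolding g by (simp add: field_simps)
        also have "\<dots> \<ge> 0"
          using c e neg \<open>0 < d\<close> \<open>1 < \<kappa>\<close>
          by (intro mult_nonneg_nonneg add_nonneg_nonneg) linarith+
        finally show ?thesis .
      qed
    qed (use T S in auto)
    also have "?\<phi> t \<le> m / \<kappa> + (m - m / \<kappa>) * (1 / 2)"
    proof (intro add_left_mono mult_left_mono)
      have "d * \<kappa> * S \<le> d * \<kappa> * (t - T)"
        using T \<open>0 < d\<close> \<open>1 < \<kappa>\<close> by (intro mult_left_mono) auto
      then have "exp (- (d * \<kappa>) * (t - T)) \<le> exp (- ln 2)" by (simp add: S(2))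
      then show "exp (- (d * \<kappa>) * (t - T)) \<le> 1 / 2" by (simp add: exp_minus)
    qed (use m\<kappa> in simp)
    also have "\<dots> = m * \<theta>" by (simp add: \<theta>_def field_simps)
    finally show ?thesis by simp
  qed
  have iter: "U x - u t x \<le> B * \<theta> ^ n" if "real n * S \<le> t" for n t x
    using that
  proof (induction n arbitrary: t x)
    case 0
    then show ?case using U(2)[of x] nonneg[of t x] by (auto simp: abs_le_iff)
  next
    case (Suc n)
    have "U x - u t x \<le> B * \<theta> ^ n * \<theta>"
      using B \<theta> S(1) Suc by (intro improve[of _ "real n * S"]) (auto simp: algebra_simps)
    then show ?case by (simp add: mult_ac)
  qed
  show ?thesis
    unfolding le_liminf_uniformly_on_def
  proof (intro allI impI)
    fix \<epsilon> :: real assume "0 < \<epsilon>"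
    have "(\<lambda>n. B * \<theta> ^ n) \<longlonglongrightarrow> 0"
      using \<theta> by (intro tendsto_mult_right_zero LIMSEQ_power_zero) auto
    then obtain n where n: "B * \<theta> ^ n < \<epsilon>"
      using \<open>0 < \<epsilon>\<close> by (metis (no_types, lifting) order_tendstoD(2) eventually_sequentially order_refl)
    \<comment> \<open>The summand \<open>1\<close> makes the waiting time positive also for
      \<open>n = 0\<close>.\<close>
    have "U x - \<epsilon> \<le> u t x" if "real n * S + 1 \<le> t" for t x
      using iter[of n t x] that n by simp
    moreover have "0 < real n * S + 1" using S(1) by (simp add: add_nonneg_pos)
    ultimately show "\<exists>T>0. \<forall>t\<ge>T. \<forall>x\<in>A. U x - \<epsilon> \<le> u t x" by blast
  qed
qed

section \<open>Choice of the constants and comparison with the ground state\<close>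

theorem proposition4p2:
  fixes f g :: "real \<Rightarrow> real" and a d \<beta> \<gamma> u\<^sub>p :: real
  assumes "d > 0"
    and "smooth_real f"
    and "0 < a" "a < 1"
    and "f 0 = 0" "f a = 0" "f 1 = 0"
    and "\<forall>u\<in>{0<..<a}. f u < 0"
    and "\<forall>u\<in>{a<..<1}. f u > 0"
    and "deriv f 0 < 0" "deriv f 1 < 0" "deriv f a > 0"
    and "integral {0..1} f > 0"
    and "g = (\<lambda>u. u - f u / d)"
    and "0 < \<beta>" "\<beta> < \<gamma>" "\<gamma> < 1"
    and "\<forall>u\<in>{0..<\<beta>} \<union> {\<gamma><..1}. deriv g u > 0"
    and "\<forall>u\<in>{\<beta><..<\<gamma>}. deriv g u < 0"
    and "deriv g \<beta> = 0" "deriv g \<gamma> = 0"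
    and "\<gamma> < u\<^sub>p" "u\<^sub>p < 1"
    and "deriv f u\<^sub>p = 0"
    and "\<forall>u\<in>{u\<^sub>p<..1}. deriv f u < 0"
    and "g u\<^sub>p < 0"
  shows "\<forall>l>0. \<forall>u. cauchy_solution exp_kernel d f (indicat_real {-l..l}) u \<longrightarrow>
    (\<exists>U x0. 0 < x0 \<and> x0 \<le> l \<and> ground_state exp_kernel d f U \<and>
       {x. \<not> isCont U x} = {x0, -x0} \<and>
       le_liminf_uniformly_on (UNIV - {x0, -x0}) U u)"
proof (intro allI impI)
  fix l :: real and u
  assume "0 < l" and u: "cauchy_solution exp_kernel d f (indicat_real {- l..l}) u"
  note g = \<open>g = (\<lambda>u. u - f u / d)\<close>
  \<comment> \<open>These two instances give the derivative of \<open>f\<close> and its continuity;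
    the latter spreads \<open>\<kappa> < g'\<close> from the points \<open>0\<close> and
    \<open>b\<close> to neighbourhoods.\<close>
  have "(deriv ^^ 0) f differentiable_on UNIV" "(deriv ^^ 1) f differentiable_on UNIV"
    using \<open>smooth_real f\<close> by (auto simp only: smooth_real_def)
  then have df: "(f has_real_derivative deriv f x) (at x)"
    and df_cont: "continuous_on UNIV (deriv f)" for x
    by (auto simp: DERIV_deriv_iff_real_differentiable differentiable_on_def
        intro: differentiable_imp_continuous_on)
  define g' where "g' x = 1 - deriv f x / d" for x
  have dg: "(g has_real_derivative g' x) (at x)" for x
    unfolding g g'_def using \<open>d > 0\<close> by (auto intro!: derivative_eq_intros df)
  have g_cont: "continuous_on S g" for S
    using dg by (meson DERIV_continuous_on has_field_derivative_at_within)
  have g'_cont: "isCont g' x" for x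
    using df_cont \<open>d > 0\<close> unfolding g'_def
    by (auto simp: continuous_on_eq_continuous_at intro!: continuous_intros)
  have g0: "g 0 = 0" and g1: "g 1 = 1" using assms by auto
  obtain b where b: "u\<^sub>p \<le> b" "b \<le> 1" "g b = 0"
    using IVT'[of g u\<^sub>p 0 1] \<open>g u\<^sub>p < 0\<close> g1 \<open>u\<^sub>p < 1\<close> g_cont by auto
  \<comment> \<open>Strictness puts \<open>b\<close> where \<open>deriv f < 0\<close>, whence
    \<open>1 < g' b\<close>.\<close>
  then have "u\<^sub>p < b" using \<open>g u\<^sub>p < 0\<close> by (cases "u\<^sub>p = b") auto
  have "0 < b" using \<open>u\<^sub>p < b\<close> assms by linarith
  have "1 < g' 0" "1 < g' b"
    using assms b(2) \<open>u\<^sub>p < b\<close> by (auto simp: g'_def divide_neg_pos)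
  then obtain \<kappa> where \<kappa>: "1 < \<kappa>" "\<kappa> < g' 0" "\<kappa> < g' b"
    using dense[of 1 "min (g' 0) (g' b)"] by auto
  have near: "\<exists>\<delta>>0. \<forall>x. \<bar>x - y\<bar> < \<delta> \<longrightarrow> \<kappa> < g' x" if "\<kappa> < g' y" for y
  proof -
    have "(g' \<longlongrightarrow> g' y) (nhds y)"
      using g'_cont[of y] by (simp add: isCont_def tendsto_at_iff_tendsto_nhds)
    from order_tendstoD(1)[OF this that] have "\<forall>\<^sub>F x in nhds y. \<kappa> < g' x" .
    then show ?thesis by (auto simp: eventually_nhds_metric dist_real_def)
  qed
  obtain \<delta>0 \<delta>b where \<delta>0: "0 < \<delta>0" "\<And>x. \<bar>x - 0\<bar> < \<delta>0 \<Longrightarrow> \<kappa> < g' x"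
    and \<delta>b: "0 < \<delta>b" "\<And>x. \<bar>x - b\<bar> < \<delta>b \<Longrightarrow> \<kappa> < g' x"
    using near[OF \<kappa>(2)] near[OF \<kappa>(3)] by blast
  define r where "r = min (min \<delta>0 \<delta>b) b / 2"
  have r: "0 < r" "r < \<delta>0" "r < \<delta>b" "r < b"
    using \<delta>0(1) \<delta>b(1) \<open>0 < b\<close> by (auto simp: r_def)
  \<comment> \<open>Both expansion intervals are two-sided: the right halves carry the branches and
    the final comparison, the left halves give the sign of \<open>f\<close> below \<open>0\<close>
    and of \<open>g\<close> below \<open>b\<close>.\<close>
  have exp0: "\<kappa> * (y - x) \<le> g y - g x" if "- r \<le> x" "x \<le> y" "y \<le> r" for x y
    using dg by (rule expand_of_deriv[where p = "- r" and q = r])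
      (use \<delta>0(2) r that in \<open>auto intro: less_imp_le\<close>)
  have expb: "\<kappa> * (y - x) \<le> g y - g x" if "b - r \<le> x" "x \<le> y" "y \<le> b + r" for x y
    using dg by (rule expand_of_deriv[where p = "b - r" and q = "b + r"])
      (use \<delta>b(2) r that in \<open>auto intro: less_imp_le\<close>)
  obtain hm where hm: "continuous_on UNIV hm" "mono hm" "\<And>s. hm s \<in> {0..0 + r}"
    "\<And>s. 0 \<le> s \<Longrightarrow> s \<le> \<kappa> * r \<Longrightarrow> g (hm s) = s"
    "\<And>s. 0 \<le> s \<Longrightarrow> s \<le> \<kappa> * r \<Longrightarrow> hm s \<le> 0 + s / \<kappa>"
    by (rule local_inverse[of \<kappa> r 0 g]) (use \<kappa> r g0 exp0 g_cont in auto)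
  obtain hp where hp: "continuous_on UNIV hp" "mono hp" "\<And>s. hp s \<in> {b..b + r}"
    "\<And>s. 0 \<le> s \<Longrightarrow> s \<le> \<kappa> * r \<Longrightarrow> g (hp s) = s"
    "\<And>s. 0 \<le> s \<Longrightarrow> s \<le> \<kappa> * r \<Longrightarrow> hp s \<le> b + s / \<kappa>"
    by (rule local_inverse[of \<kappa> r b g]) (use \<kappa> r b expb g_cont in auto)
  \<comment> \<open>Then \<open>\<kappa> * (1 - \<mu>) = (\<kappa> + 1) / 2 > 1\<close>, so
    spreading the weight by the kernel costs less than the branches gain.\<close>
  define \<mu> where "\<mu> = (1 - 1 / \<kappa>) / 2"
  have \<mu>: "0 < \<mu>" "\<mu> < 1" "1 < \<kappa> * (1 - \<mu>)"
    using \<kappa>(1) by (auto simp: \<mu>_def field_simps)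
  \<comment> \<open>The room that the tail term leaves in \<open>small\<close> for the contribution
    of the plateau.\<close>
  define gap where "gap = \<kappa> * r - r / (1 - \<mu>)"
  have gap: "0 < gap"
    using \<mu> r(1) mult_strict_right_mono[OF \<mu>(3) r(1)] by (simp add: gap_def field_simps)
  \<comment> \<open>The bound \<open>l\<close> keeps the plateau of \<open>U\<close> inside the
    initial support, \<open>1\<close> allows \<open>exp x0 \<le> exp 1\<close>, and the last term
    makes the plateau fit into \<open>gap\<close>.\<close>
  define x0 where "x0 = min (min l 1) (gap / (b * exp 1))"
  have x0: "0 < x0" "x0 \<le> l" "x0 \<le> 1" "x0 \<le> gap / (b * exp 1)"
    using \<open>0 < l\<close> gap \<open>0 < b\<close> by (auto simp: x0_def)
  have "b * x0 * exp x0 \<le> b * x0 * exp 1"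
    using x0 \<open>0 < b\<close> by (intro mult_left_mono) auto
  also have "\<dots> \<le> gap" using x0(4) \<open>0 < b\<close> by (simp add: field_simps)
  finally have small: "b * x0 * exp x0 + r / (1 - \<mu>) \<le> \<kappa> * r" by (simp add: gap_def)
  obtain U where U: "U \<in> borel_measurable lborel" "\<And>x. U (- x) = U x" "\<And>x. 0 \<le> U x"
    "\<And>x. U x \<le> b * indicat_real {- x0..x0} x + r * exp (- \<mu> * \<bar>x\<bar>)"
    and fixU: "\<And>x. U x = (if \<bar>x\<bar> \<le> x0 then hp else hm) (conv exp_kernel U x)"
    and range: "\<And>x. 0 \<le> conv exp_kernel U x" "\<And>x. conv exp_kernel U x \<le> \<kappa> * r"
    by (rule branch_fixed_point[of hp b \<kappa> r hm x0 \<mu>])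
      (use hp hm \<kappa> r \<open>0 < b\<close> x0 \<mu> small in auto)
  have "b \<le> hp s" "hm s \<in> {0..r}" for s using hp(3)[of s] hm(3)[of s] by auto
  note gs = ground_state_of_branches[OF hp(1) this(1) hp(4) hm(1) this(2) hm(4)
    \<open>d > 0\<close> r(1,4) x0(1) \<mu>(1) g g0 U fixU range]
  \<comment> \<open>On \<open>[- r, 0]\<close> expansion gives
    \<open>g s \<le> \<kappa> * s \<le> s\<close>, and \<open>f s = d * (s - g s)\<close>.\<close>
  obtain \<eta> where \<eta>: "0 < \<eta>" "\<And>s. - \<eta> \<le> s \<Longrightarrow> s \<le> 0 \<Longrightarrow> 0 \<le> f s"
  proof (rule that[OF r(1)])
    fix s assume s: "- r \<le> s" "s \<le> 0"
    have "\<kappa> * s \<le> 1 * s" using \<kappa>(1) s by (intro mult_right_mono_neg) auto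
    with exp0[of s 0] s r g0 have "g s \<le> s" by auto
    then show "0 \<le> f s" using \<open>d > 0\<close> by (simp add: g zero_le_divide_iff)
  qed
  have nonneg: "0 \<le> u t x" if "0 \<le> t" for t x
    by (rule cauchy_solution_nonneg[OF u \<open>d > 0\<close> \<eta> _ that]) auto
  have plateau: "b \<le> u t x" if "0 \<le> t" "\<bar>x\<bar> \<le> l" for t x
  proof (rule cauchy_solution_ge_plateau[OF u \<open>d > 0\<close> r(1) g _ nonneg _ that(1)])
    show "g s \<le> 0" if "b - r < s" "s < b" for s
    proof -
      have "0 \<le> \<kappa> * (b - s)" using that \<kappa>(1) by simp
      with expb[of s b] that r(1) b(3) show ?thesis by linarith
    qed
    show "b \<le> u 0 x" using u that(2) b(2) by (auto simp: cauchy_solution_def indicator_def)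
  qed
  have "le_liminf_uniformly_on (UNIV - {x0, - x0}) U u"
  proof (rule stationary_le_liminf[OF u \<open>d > 0\<close> \<kappa>(1) g U(1) _ gs(3) nonneg])
    have range_U: "U x \<in> (if \<bar>x\<bar> \<le> x0 then {b..b + r} else {0..r})" for x
      using fixU[of x] hp(3) hm(3) by auto
    show "\<bar>U x\<bar> \<le> b + r" for x using range_U[of x] \<open>0 < b\<close> r by (auto split: if_splits)
    \<comment> \<open>If \<open>u t x < U x\<close>, both values lie in \<open>[b, b + r]\<close> on
      the plateau, by \<open>plateau\<close> and \<open>x0 \<le> l\<close>, and in
      \<open>[0, r]\<close> elsewhere, by \<open>nonneg\<close>.\<close>
    show "\<kappa> * (U x - u t x) \<le> g (U x) - g (u t x)" if "0 \<le> t" "u t x < U x" for t x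
    proof (cases "\<bar>x\<bar> \<le> x0")
      case True
      then show ?thesis using range_U[of x] plateau[of t x] that x0 r by (intro expb) auto
    next
      case False
      then show ?thesis using range_U[of x] nonneg[of t x] that r by (intro exp0) auto
    qed
  qed
  with gs(1,2) x0(1,2) show "\<exists>U x0. 0 < x0 \<and> x0 \<le> l \<and> ground_state exp_kernel d f U \<and>
       {x. \<not> isCont U x} = {x0, -x0} \<and> le_liminf_uniformly_on (UNIV - {x0, -x0}) U u"
    by blast
qed

end
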